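(* Let $G=\langle G_x:x\in I\rangle$ be a system of mutually disjoint, finite, cyclic groups, and $\mathcal E$ an equivalence relation on $I$. For each system $m=\langle m_{xy}:(x,y)\in\mathcal E\rangle$ of positive integers satisfying the index conditions, there exists a system of quotient isomorphisms $\varphi=\langle\varphi_{xy}:(x,y)\in\mathcal E\rangle$, with $\varphi_{xy}$ an isomorphism from a quotient $G_x/H_{xy}$ to a quotient $G_y/K_{xy}$, such that the group pair $\mathcal F=(G,\varphi)$ satisfies the four frame conditions and is therefore a group frame. The corresponding group relation algebra determined by $\mathcal F$ therefore exists. Moreover, $m_{xy}=|G_x/H_{xy}|$ for all $(x,y)\in\mathcal E$, where $H_{xy}$ is the kernel of $\varphi_{xy}$.
   Context: Index conditions: a system $m=\langle m_{xy}:(x,y)\in\mathcal E\rangle$ of positive integers satisfies the index conditions (with respect to $G$) if, for all $(x,y),(y,z)\in\mathcal E$: (i) $m_{xy}$ is a common divisor of the orders of $G_x$ and $G_y$; (ii) $m_{xx}=|G_x|$; (iii) $m_{yx}=m_{xy}$; (iv) $\gcd(m_{xy},m_{yz})=\gcd(m_{xy},m_{xz})=\gcd(m_{xz},m_{yz})$. A group pair is $\mathcal F=(\langle G_x:x\in I\rangle,\langle\varphi_{xy}:(x,y)\in\mathcal E\rangle)$, where the $G_x$ are pairwise disjoint groups (operation $\circ$, identity $e_x$), $\mathcal E$ is an equivalence relation on $I$, and for each $(x,y)\in\mathcal E$, $\varphi_{xy}$ is an isomorphism from $G_x/H_{xy}$ to $G_y/K_{xy}$ for some normal subgroups $H_{xy}$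 of $G_x$ and $K_{xy}$ of $G_y$. The subgroup $H_{xy}$ is called the kernel of $\varphi_{xy}$. For subgroups $H,K$ of a group, $H\circ K=\{h\circ k:h\in H,k\in K\}$. For a normal subgroup $N$ of $G_x$ that contains $H_{xy}$, $\varphi_{xy}[N]$ is the union of the images under $\varphi_{xy}$ of the cosets of $H_{xy}$ contained in $N$. A group frame is a group pair satisfying the four frame conditions, for all $(x,y),(y,z)\in\mathcal E$: (i) $\varphi_{xx}$ is the identity automorphism of $G_x/\{e_x\}$ for all $x\in I$; (ii) $\varphi_{yx}=\varphi_{xy}^{-1}$; (iii) $\varphi_{xy}[H_{xy}\circ H_{xz}]=K_{xy}\circ H_{yz}$; (iv) $\hat\varphi_{xy}\mid\hat\varphi_{yz}=\hat\varphi_{xz}$. Here $\hat\varphi_{xy}:G_x/(H_{xy}\circ H_{xz})\to G_y/(K_{xy}\circ H_{yz})$, $\hat\varphi_{yz}:G_y/(K_{xy}\circ H_{yz})\to G_z/(K_{xz}\circ K_{yz})$ and $\hat\varphi_{xz}:G_x/(H_{xy}\circ H_{xz})\to G_z/(K_{xz}\circ K_{yz})$ are the isomorphisms induced by $\varphi_{xy},\varphi_{yz},\varphi_{xz}$ respectively (each sends a coset, viewed as a union of cosets of the smaller kernel subgroup, to the union of the images of these cosets), and $\mid$ denotes composition, first the left function and then the right one. Group relation algebra of $\mathcal F$: let $(H_{xy,\alpha}:\alpha<\kappa_{xy})$ list the cosets of $H_{xy}$ in $G_x$ and put $R_{xy,\alpha}=\bigcup_{\gamma<\kappa_{xy}}H_{xy,\gamma}\times\varphi_{xy}(H_{xy,\gamma}\circ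 H_{xy,\alpha})$. Let $A$ be the set of all binary relations of the form $\bigcup\{R_{xy,\alpha}:(x,y,\alpha)\in X\}$ with $X\subseteq\{(x,y,\alpha):(x,y)\in\mathcal E,\ \alpha<\kappa_{xy}\}$. The group relation algebra exists when $A$ is closed under the Boolean set-theoretic operations (complement relative to the largest relation in $A$), contains the identity relation on $\bigcup_{x\in I}G_x$, and is closed under relational composition and converse; it is then the algebra of relations with universe $A$. It is known that this is the case for every group frame. *)

theory Defs
  imports "HOL-Algebra.Elementary_Groups" "HOL-Library.Disjoint_Sets"
begin

definition index_conditions ::
    "'i rel \<Rightarrow> ('i \<Rightarrow> ('a, 'b) monoid_scheme) \<Rightarrow> ('i \<Rightarrow> 'i \<Rightarrow> nat) \<Rightarrow> bool" where
  "index_conditions E G m \<longleftrightarrow>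
     (\<forall>x y z. (x, y) \<in> E \<longrightarrow> (y, z) \<in> E \<longrightarrow>
        (m x y dvd order (G x) \<and> m x y dvd order (G y)) \<and>
        m x x = order (G x) \<and>
        m y x = m x y \<and>
        gcd (m x y) (m y z) = gcd (m x y) (m x z) \<and>
        gcd (m x y) (m x z) = gcd (m x z) (m y z))"

text \<open>
  The value on \<open>N\<close> of a map \<open>f\<close> that is defined on the cosets of \<open>H\<close> in \<open>G\<close>: the union of the
  images of the cosets of \<open>H\<close> contained in \<open>N\<close>. With \<open>N\<close> a normal subgroup this is
  \<open>f[N]\<close>; with \<open>N\<close> a coset of a normal subgroup \<open>M\<close> including \<open>H\<close> it is the value at \<open>N\<close> of the
  map that \<open>f\<close> induces on the quotient of \<open>G\<close> by \<open>M\<close>.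
\<close>

definition coset_union_image ::
    "('a, 'b) monoid_scheme \<Rightarrow> 'a set \<Rightarrow> ('a set \<Rightarrow> 'c set) \<Rightarrow> 'a set \<Rightarrow> 'c set" where
  "coset_union_image G H f N = \<Union> (f ` {C \<in> rcosets\<^bsub>G\<^esub> H. C \<subseteq> N})"

text \<open>
  The domain and codomain of an isomorphism of quotients are carried as separate families
  \<open>H\<close> (the kernels) and \<open>K\<close>. The values of \<open>H\<close>, \<open>K\<close>, \<open>\<phi>\<close> at pairs outside \<open>E\<close>,
  and of \<open>\<phi> x y\<close> at sets that are not cosets of \<open>H x y\<close>, are irrelevant.
\<close>

locale group_pair =
  fixes I :: "'i set" and E :: "'i rel"
    and G :: "'i \<Rightarrow> ('a, 'b) monoid_scheme"
    and H K :: "'i \<Rightarrow> 'i \<Rightarrow> 'a set"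
    and \<phi> :: "'i \<Rightarrow> 'i \<Rightarrow> 'a set \<Rightarrow> 'a set"
  assumes equiv_E: "equiv I E"
    and group_G: "x \<in> I \<Longrightarrow> group (G x)"
    and disjoint_G: "disjoint_family_on (\<lambda>x. carrier (G x)) I"
    and normal_H: "(x, y) \<in> E \<Longrightarrow> H x y \<lhd> G x"
    and normal_K: "(x, y) \<in> E \<Longrightarrow> K x y \<lhd> G y"
    and iso_\<phi>: "(x, y) \<in> E \<Longrightarrow> \<phi> x y \<in> iso (G x Mod H x y) (G y Mod K x y)"
begin

text \<open>
  The relations \<open>R\<^sub>x\<^sub>y\<^sub>,\<^sub>\<alpha>\<close>, indexed by the coset \<open>C = H\<^sub>x\<^sub>y\<^sub>,\<^sub>\<alpha>\<close> itself instead of by its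
  position \<open>\<alpha>\<close> in a list of the cosets.
\<close>

definition atomic_rel :: "'i \<Rightarrow> 'i \<Rightarrow> 'a set \<Rightarrow> 'a rel" where
  "atomic_rel x y C = (\<Union>D \<in> rcosets\<^bsub>G x\<^esub> (H x y). D \<times> \<phi> x y (D <#>\<^bsub>G x\<^esub> C))"

definition group_relations :: "'a rel set" where
  "group_relations =
     {R. \<exists>X \<subseteq> {(x, y, C). (x, y) \<in> E \<and> C \<in> rcosets\<^bsub>G x\<^esub> (H x y)}.
        R = (\<Union>(x, y, C) \<in> X. atomic_rel x y C)}"

text \<open>
  The union of all members of \<open>group_relations\<close> is itself a member, the largest one;
  complements are taken relative to it.
\<close>

definition group_relation_algebra_exists :: bool where
  "group_relation_algebra_exists \<longleftrightarrow>
     (\<forall>R \<in> group_relations. \<forall>S \<in> group_relations.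
        R \<union> S \<in> group_relations \<and> R \<inter> S \<in> group_relations) \<and>
     (\<forall>R \<in> group_relations. \<Union> group_relations - R \<in> group_relations) \<and>
     Id_on (\<Union>x \<in> I. carrier (G x)) \<in> group_relations \<and>
     (\<forall>R \<in> group_relations. \<forall>S \<in> group_relations. R O S \<in> group_relations) \<and>
     (\<forall>R \<in> group_relations. R\<inverse> \<in> group_relations)"

end

text \<open>
  In the last condition, the third one, applied also to the pairs \<open>(y, z)\<close>, \<open>(z, x)\<close> and
  \<open>(x, z)\<close>, \<open>(z, y)\<close>, together with the second one, shows that the induced maps have matching
  domains and codomains.
\<close>

locale group_frame = group_pair +
  assumes identity_H: "x \<in> I \<Longrightarrow> H x x = {\<one>\<^bsub>G x\<^esub>}"
    and identity_K: "x \<in> I \<Longrightarrow> K x x = {\<one>\<^bsub>G x\<^esub>}"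
    and identity_\<phi>: "\<lbrakk>x \<in> I; C \<in> carrier (G x Mod {\<one>\<^bsub>G x\<^esub>})\<rbrakk> \<Longrightarrow> \<phi> x x C = C"
    and inverse_H: "(x, y) \<in> E \<Longrightarrow> H y x = K x y"
    and inverse_K: "(x, y) \<in> E \<Longrightarrow> K y x = H x y"
    and inverse_\<phi>: "\<lbrakk>(x, y) \<in> E; D \<in> carrier (G y Mod K x y)\<rbrakk> \<Longrightarrow>
          \<phi> y x D = inv_into (carrier (G x Mod H x y)) (\<phi> x y) D"
    and image_\<phi>: "\<lbrakk>(x, y) \<in> E; (y, z) \<in> E\<rbrakk> \<Longrightarrow>
          coset_union_image (G x) (H x y) (\<phi> x y) (H x y <#>\<^bsub>G x\<^esub> H x z) =
          K x y <#>\<^bsub>G y\<^esub> H y z"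
    and composition_\<phi>: "\<lbrakk>(x, y) \<in> E; (y, z) \<in> E;
            C \<in> carrier (G x Mod (H x y <#>\<^bsub>G x\<^esub> H x z))\<rbrakk> \<Longrightarrow>
          coset_union_image (G y) (H y z) (\<phi> y z) (coset_union_image (G x) (H x y) (\<phi> x y) C) =
          coset_union_image (G x) (H x z) (\<phi> x z) C"

end

theory Submission
  imports Defs "HOL-Algebra.Multiplicative_Group" "HOL-Number_Theory.Cong"
begin

text \<open>
  Choose a generator \<open>g x\<close> of every group \<open>G x\<close> and write its elements as powers of \<open>g x\<close> with
  integer exponents. The exponent of an element is determined modulo the order of \<open>G x\<close>, hence,
  by the first index condition, also modulo every \<open>m x y\<close>. Let \<open>H x y\<close> consist of the powers of
  \<open>g x\<close> whose exponents are multiples of \<open>m x y\<close>, let \<open>K x y = H y x\<close>, and let \<open>\<phi> x y\<close> preserve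
  exponents: it sends the coset of the exponents congruent to \<open>k\<close> modulo \<open>m x y\<close> in \<open>G x\<close> to the
  coset of the same exponents in \<open>G y\<close>.

  Because all these maps do nothing to exponents, the frame conditions reduce to statements about
  moduli. The complex product of \<open>H x y\<close> and \<open>H x z\<close> consists of the powers with exponents
  divisible by \<open>gcd (m x y) (m x z)\<close> (\<open>exponent_class_set_mult\<close>). By the last index condition this
  gcd is the same for all three pairs formed from \<open>m x y\<close>, \<open>m x z\<close>, \<open>m y z\<close>, so the induced maps
  have matching domains and codomains (\<open>image_exponent_map\<close>), and their composition law is the
  identity of exponents.

  For the algebra of relations, the atomic relations are exactly the sets of pairs
  \<open>(g x ^ i, g y ^ j)\<close> in which \<open>j - i\<close> lies in a given residue class modulo \<open>m x y\<close>. A relation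
  between elements of groups with equivalent indices is therefore a union of atomic ones iff
  membership of such a pair depends only on the residue class of \<open>j - i\<close>
  (\<open>group_relations_eq_saturated\<close>). Closure under the Boolean operations and under converse can
  be read off this criterion; the identity relation satisfies it because \<open>m x x\<close> is the order of
  \<open>G x\<close>, so that equal residues modulo \<open>m x x\<close> mean equal elements. Closure under composition is
  an instance of the Chinese remainder theorem: the middle exponent has to satisfy one congruence
  modulo \<open>m x y\<close> and one modulo \<open>m y z\<close>, and these are compatible because
  \<open>gcd (m x y) (m y z)\<close> divides \<open>m x z\<close>.
\<close>

section \<open>Congruence classes of powers in a cyclic group\<close>

lemma simultaneous_congruence:
  fixes a b p q :: int
  assumes "[a = b] (mod gcd p q)"
  obtains j where "[j = a] (mod p)" and "[j = b] (mod q)"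
proof -
  from assms obtain t where t: "a - b = gcd p q * t"
    by (auto simp: cong_iff_dvd_diff)
  obtain u v where uv: "u * p + v * q = gcd p q"
    using bezout_int by blast
  have *: "a - b = (u * p + v * q) * t" by (simp add: t uv)
  have "a - u * p * t - a = p * (- u * t)" "a - u * p * t - b = q * (v * t)"
    using * by (simp_all add: algebra_simps)
  then have "[a - u * p * t = a] (mod p)" "[a - u * p * t = b] (mod q)"
    unfolding cong_iff_dvd_diff by (metis dvd_triv_left)+
  then show thesis by (rule that)
qed

definition exponent_class :: "('a, 'b) monoid_scheme \<Rightarrow> 'a \<Rightarrow> nat \<Rightarrow> int \<Rightarrow> 'a set" where
  "exponent_class G g d k = (\<lambda>l. g [^]\<^bsub>G\<^esub> l) ` {l. [l = k] (mod int d)}"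

locale generated_cyclic = comm_group G for G (structure) +
  fixes g
  assumes generator_closed: "g \<in> carrier G"
    and carrier_eq_powers: "carrier G = range (\<lambda>k::int. g [^] k)"
begin

lemma power_closed [simp]: "g [^] (k::int) \<in> carrier G"
  using generator_closed by simp

text \<open>
  In an infinite cyclic group \<open>order G\<close> is 0, and congruence modulo 0 is equality, as it should be.
\<close>

lemma power_eq_iff: "g [^] (k::int) = g [^] l \<longleftrightarrow> [k = l] (mod int (order G))"
proof -
  have "carrier (subgroup_generated G {g}) = carrier G"
    using carrier_subgroup_generated_by_singleton[OF generator_closed] carrier_eq_powers by simp
  then have "generate G {g} = carrier G"
    using generator_closed by (simp add: carrier_subgroup_generated)
  then have "ord g = order G"
    using generate_pow_card[OF generator_closed] by (simp add: order_def)
  then show ?thesis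
    using int_pow_eq[OF generator_closed, of k l]
    by (simp add: cong_iff_dvd_diff dvd_diff_commute)
qed

text \<open>The divisibility makes membership depend on the element, not on the chosen exponent.\<close>

lemma power_in_exponent_class_iff:
  assumes "d dvd order G"
  shows "g [^] l \<in> exponent_class G g d k \<longleftrightarrow> [l = k] (mod int d)"
proof
  assume "g [^] l \<in> exponent_class G g d k"
  then obtain l' where l': "[l' = k] (mod int d)" "[l = l'] (mod int (order G))"
    by (auto simp: exponent_class_def power_eq_iff)
  then have "[l = l'] (mod int d)"
    using assms by (auto intro: cong_dvd_modulus)
  then show "[l = k] (mod int d)" using l'(1) by (rule cong_trans)
qed (auto simp: exponent_class_def)

lemma exponent_class_mono:
  assumes "[k = l] (mod int d)" and "d dvd e"
  shows "exponent_class G g e k \<subseteq> exponent_class G g d l"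
  using assms unfolding exponent_class_def
  by (auto intro!: imageI) (meson cong_dvd_modulus cong_trans int_dvd_int_iff)

lemma exponent_class_subset_iff:
  assumes "d dvd e" and "e dvd order G"
  shows "exponent_class G g e k \<subseteq> exponent_class G g d l \<longleftrightarrow> [k = l] (mod int d)"
proof
  assume "exponent_class G g e k \<subseteq> exponent_class G g d l"
  moreover have "g [^] k \<in> exponent_class G g e k" by (auto simp: exponent_class_def)
  ultimately have "g [^] k \<in> exponent_class G g d l" by blast
  then show "[k = l] (mod int d)"
    using power_in_exponent_class_iff[of d] assms dvd_trans by blast
qed (use assms exponent_class_mono in blast)

lemma exponent_class_eq_iff:
  assumes "d dvd order G"
  shows "exponent_class G g d k = exponent_class G g d l \<longleftrightarrow> [k = l] (mod int d)"
  using exponent_class_subset_iff[of d d, OF _ assms] by (metis cong_sym dvd_refl subset_antisym subset_refl)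

text \<open>
  Sums of a number congruent to \<open>i\<close> modulo \<open>d\<close> and one congruent to \<open>j\<close> modulo \<open>e\<close> exhaust the
  residue class of \<open>i + j\<close> modulo \<open>gcd d e\<close>: splitting a given \<open>l\<close> amounts to solving two
  congruences for the first summand. The case \<open>d = e\<close> is the multiplication of cosets, the case
  \<open>i = j = 0\<close> the product of two subgroups.
\<close>

lemma exponent_class_set_mult:
  "exponent_class G g d i <#> exponent_class G g e j = exponent_class G g (gcd d e) (i + j)"
proof
  show "exponent_class G g d i <#> exponent_class G g e j \<subseteq> exponent_class G g (gcd d e) (i + j)"
  proof
    fix a assume "a \<in> exponent_class G g d i <#> exponent_class G g e j"
    then obtain k l where kl: "[k = i] (mod int d)" "[l = j] (mod int e)" "a = g [^] k \<otimes> g [^] l"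
      unfolding set_mult_def exponent_class_def by auto
    then have "[k + l = i + j] (mod int (gcd d e))"
      by (intro cong_add) (auto intro: cong_dvd_modulus)
    then show "a \<in> exponent_class G g (gcd d e) (i + j)"
      using kl(3) generator_closed by (auto simp: exponent_class_def simp flip: int_pow_mult)
  qed
next
  show "exponent_class G g (gcd d e) (i + j) \<subseteq> exponent_class G g d i <#> exponent_class G g e j"
  proof
    fix a assume "a \<in> exponent_class G g (gcd d e) (i + j)"
    then obtain l where l: "[l = i + j] (mod int (gcd d e))" "a = g [^] l"
      by (auto simp: exponent_class_def)
    have "[i = l - j] (mod gcd (int d) (int e))"
      using cong_diff[OF cong_sym[OF l(1)] cong_refl[of j]] by simp
    then obtain k where k: "[k = i] (mod int d)" "[k = l - j] (mod int e)"
      by (rule simultaneous_congruence)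
    have "[l - k = j] (mod int e)"
      using k(2) by (simp add: cong_iff_dvd_diff algebra_simps dvd_diff_commute)
    moreover have "a = g [^] k \<otimes> g [^] (l - k)"
      using l(2) generator_closed by (simp flip: int_pow_mult)
    ultimately show "a \<in> exponent_class G g d i <#> exponent_class G g e j"
      using k(1) unfolding set_mult_def exponent_class_def by blast
  qed
qed

lemma subgroup_exponent_class: "subgroup (exponent_class G g d 0) G"
proof
  show "exponent_class G g d 0 \<subseteq> carrier G" by (auto simp: exponent_class_def)
  show "\<one> \<in> exponent_class G g d 0"
    unfolding exponent_class_def by (rule image_eqI[of _ _ 0]) auto
  show "a \<otimes> b \<in> exponent_class G g d 0"
    if "a \<in> exponent_class G g d 0" "b \<in> exponent_class G g d 0" for a b
    using that exponent_class_set_mult[of d 0 d 0] by (auto simp: set_mult_def)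
  show "inv a \<in> exponent_class G g d 0" if "a \<in> exponent_class G g d 0" for a
  proof -
    from that obtain l where "a = g [^] l" "int d dvd l"
      by (auto simp: exponent_class_def cong_0_iff)
    then have "inv a = g [^] (- l)" "int d dvd - l"
      using generator_closed by (auto simp: int_pow_neg)
    then show ?thesis by (auto simp: exponent_class_def cong_0_iff)
  qed
qed

lemma normal_exponent_class: "exponent_class G g d 0 \<lhd> G"
  by (rule subgroup_imp_normal[OF subgroup_exponent_class])

lemma rcosets_exponent_class: "rcosets (exponent_class G g d 0) = range (exponent_class G g d)"
proof -
  have "exponent_class G g d 0 #> g [^] k = exponent_class G g d k" for k :: int
  proof -
    \<comment> \<open>Modulus 0 turns a residue class into a single exponent.\<close>
    have "{g [^] k} = exponent_class G g 0 k" by (simp add: exponent_class_def cong_0_iff cong_iff_dvd_diff)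
    then show ?thesis
      by (simp add: r_coset_eq_set_mult exponent_class_set_mult)
  qed
  then show ?thesis by (auto simp: RCOSETS_def carrier_eq_powers)
qed

lemma carrier_quotient: "carrier (G Mod exponent_class G g d 0) = range (exponent_class G g d)"
  by (simp add: FactGroup_def rcosets_exponent_class)

lemma order_quotient:
  assumes "d dvd order G" and "d > 0"
  shows "order (G Mod exponent_class G g d 0) = d"
proof -
  have "range (exponent_class G g d) = exponent_class G g d ` {0..<int d}"
  proof -
    have "exponent_class G g d k = exponent_class G g d (k mod int d)" for k
      using assms(1) by (simp add: exponent_class_eq_iff)
    moreover have "k mod int d \<in> {0..<int d}" for k using assms(2) by simp
    ultimately show ?thesis by blast
  qed
  moreover have "inj_on (exponent_class G g d) {0..<int d}"
    using assms by (auto simp: inj_on_def exponent_class_eq_iff cong_def)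
  ultimately show ?thesis
    by (simp add: order_def carrier_quotient card_image)
qed

lemma exponent_class_order: "exponent_class G g (order G) k = {g [^] k}"
  by (auto simp: exponent_class_def power_eq_iff)

end

section \<open>The exponent-preserving quotient isomorphisms\<close>

locale cyclic_system =
  fixes I :: "'i set" and E :: "'i rel"
    and G :: "'i \<Rightarrow> ('a, 'b) monoid_scheme"
    and m :: "'i \<Rightarrow> 'i \<Rightarrow> nat"
    and g :: "'i \<Rightarrow> 'a"
  assumes equiv_E: "equiv I E"
    and generated_cyclic: "x \<in> I \<Longrightarrow> generated_cyclic (G x) (g x)"
    and disjoint_G: "disjoint_family_on (\<lambda>x. carrier (G x)) I"
    and index: "index_conditions E G m"
begin

definition gpow :: "'i \<Rightarrow> int \<Rightarrow> 'a" where
  "gpow x k = g x [^]\<^bsub>G x\<^esub> k"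

definition exp_coset :: "'i \<Rightarrow> nat \<Rightarrow> int \<Rightarrow> 'a set" where
  "exp_coset x = exponent_class (G x) (g x)"

definition kernel :: "'i \<Rightarrow> 'i \<Rightarrow> 'a set" where
  "kernel x y = exp_coset x (m x y) 0"

text \<open>
  Collecting the exponents of all elements of \<open>C\<close>, instead of the exponent of one chosen
  representative, makes the map visibly independent of the representative.
\<close>

definition exponent_map :: "'i \<Rightarrow> 'i \<Rightarrow> 'a set \<Rightarrow> 'a set" where
  "exponent_map x y C = gpow y ` {l. gpow x l \<in> C}"

lemma E_in_I: "(x, y) \<in> E \<Longrightarrow> x \<in> I" "(x, y) \<in> E \<Longrightarrow> y \<in> I"
  using equiv_E by (auto simp: equiv_def)

lemma E_refl: "x \<in> I \<Longrightarrow> (x, x) \<in> E"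
  using equiv_E by (auto simp: equiv_def refl_on_def)

lemma E_sym: "(x, y) \<in> E \<Longrightarrow> (y, x) \<in> E"
  using equiv_E by (auto simp: equiv_def sym_def)

lemma E_trans: "(x, y) \<in> E \<Longrightarrow> (y, z) \<in> E \<Longrightarrow> (x, z) \<in> E"
  using equiv_E by (auto simp: equiv_def trans_def)

lemma
  assumes "(x, y) \<in> E"
  shows m_dvd: "m x y dvd order (G x)" "m x y dvd order (G y)"
    and m_diag: "m x x = order (G x)"
    and m_sym: "m y x = m x y"
  using index assms E_sym[OF assms] unfolding index_conditions_def by blast+

lemma m_gcd:
  assumes "(x, y) \<in> E" and "(y, z) \<in> E"
  shows "gcd (m x y) (m y z) = gcd (m x y) (m x z)"
    and "gcd (m x y) (m x z) = gcd (m x z) (m y z)"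
  using index assms unfolding index_conditions_def by blast+

lemma exp_coset_eq: "exp_coset x d k = gpow x ` {l. [l = k] (mod int d)}"
  by (simp add: exp_coset_def gpow_def exponent_class_def)

lemma carrier_eq: "x \<in> I \<Longrightarrow> carrier (G x) = range (gpow x)"
  unfolding gpow_def by (rule generated_cyclic.carrier_eq_powers[OF generated_cyclic])

lemma gpow_eq_iff: "x \<in> I \<Longrightarrow> gpow x k = gpow x l \<longleftrightarrow> [k = l] (mod int (order (G x)))"
  unfolding gpow_def by (rule generated_cyclic.power_eq_iff[OF generated_cyclic])

lemma gpow_in_exp_coset_iff:
  "x \<in> I \<Longrightarrow> d dvd order (G x) \<Longrightarrow> gpow x l \<in> exp_coset x d k \<longleftrightarrow> [l = k] (mod int d)"
  unfolding gpow_def exp_coset_def by (rule generated_cyclic.power_in_exponent_class_iff[OF generated_cyclic])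

lemma exp_coset_eq_iff:
  "x \<in> I \<Longrightarrow> d dvd order (G x) \<Longrightarrow> exp_coset x d k = exp_coset x d l \<longleftrightarrow> [k = l] (mod int d)"
  unfolding exp_coset_def by (rule generated_cyclic.exponent_class_eq_iff[OF generated_cyclic])

lemma exp_coset_set_mult:
  "x \<in> I \<Longrightarrow> exp_coset x d i <#>\<^bsub>G x\<^esub> exp_coset x e j = exp_coset x (gcd d e) (i + j)"
  unfolding exp_coset_def by (rule generated_cyclic.exponent_class_set_mult[OF generated_cyclic])

lemma rcosets_exp_coset: "x \<in> I \<Longrightarrow> rcosets\<^bsub>G x\<^esub> (exp_coset x d 0) = range (exp_coset x d)"
  unfolding exp_coset_def by (rule generated_cyclic.rcosets_exponent_class[OF generated_cyclic])

lemma carrier_quotient: "x \<in> I \<Longrightarrow> carrier (G x Mod exp_coset x d 0) = range (exp_coset x d)"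
  unfolding exp_coset_def by (rule generated_cyclic.carrier_quotient[OF generated_cyclic])

lemma exp_coset_order: "x \<in> I \<Longrightarrow> exp_coset x (order (G x)) k = {gpow x k}"
  unfolding exp_coset_def gpow_def by (rule generated_cyclic.exponent_class_order[OF generated_cyclic])

lemma index_unique: "gpow x k = gpow y l \<Longrightarrow> x \<in> I \<Longrightarrow> y \<in> I \<Longrightarrow> x = y"
  using disjoint_G carrier_eq unfolding disjoint_family_on_def by blast

lemma exponent_map_exp_coset:
  "x \<in> I \<Longrightarrow> d dvd order (G x) \<Longrightarrow> exponent_map x y (exp_coset x d k) = exp_coset y d k"
  unfolding exponent_map_def by (simp add: gpow_in_exp_coset_iff) (simp add: exp_coset_eq)

text \<open>
  The induced maps on coarser quotients also preserve exponents, since a residue class modulo \<open>d\<close>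
  is the union of the classes modulo \<open>m x y\<close> of its members. Both remaining frame conditions
  follow from this.
\<close>

lemma coset_union_image_exponent_map:
  assumes "(x, y) \<in> E" and "d dvd m x y"
  shows "coset_union_image (G x) (kernel x y) (exponent_map x y) (exp_coset x d k) = exp_coset y d k"
proof -
  have x: "x \<in> I" using E_in_I assms(1) by blast
  have fc: "generated_cyclic (G x) (g x)" by (rule generated_cyclic[OF x])
  have "coset_union_image (G x) (kernel x y) (exponent_map x y) (exp_coset x d k)
      = \<Union> (exponent_map x y ` {C \<in> range (exp_coset x (m x y)). C \<subseteq> exp_coset x d k})"
    using x by (simp add: coset_union_image_def kernel_def rcosets_exp_coset)
  also have "\<dots> = \<Union> (exponent_map x y ` exp_coset x (m x y) ` {l. [l = k] (mod int d)})"
  proof -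
    have "exp_coset x (m x y) l \<subseteq> exp_coset x d k \<longleftrightarrow> [l = k] (mod int d)" for l
      unfolding exp_coset_def
      using generated_cyclic.exponent_class_subset_iff[OF fc assms(2) m_dvd(1)[OF assms(1)]] .
    then have "{C \<in> range (exp_coset x (m x y)). C \<subseteq> exp_coset x d k}
        = exp_coset x (m x y) ` {l. [l = k] (mod int d)}"
      by blast
    then show ?thesis by simp
  qed
  also have "\<dots> = (\<Union>l \<in> {l. [l = k] (mod int d)}. exp_coset y (m x y) l)"
    using x m_dvd(1)[OF assms(1)] by (simp add: exponent_map_exp_coset)
  also have "\<dots> = exp_coset y d k"
  proof
    show "(\<Union>l \<in> {l. [l = k] (mod int d)}. exp_coset y (m x y) l) \<subseteq> exp_coset y d k"
      using generated_cyclic.exponent_class_mono[OF generated_cyclic[of y]] E_in_I(2)[OF assms(1)] assms(2)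
      unfolding exp_coset_def by blast
    show "exp_coset y d k \<subseteq> (\<Union>l \<in> {l. [l = k] (mod int d)}. exp_coset y (m x y) l)"
      by (fastforce simp: exp_coset_eq)
  qed
  finally show ?thesis .
qed

lemma exponent_map_iso:
  assumes "(x, y) \<in> E"
  shows "exponent_map x y \<in> iso (G x Mod kernel x y) (G y Mod kernel y x)"
proof (rule isoI)
  note x = E_in_I(1)[OF assms] and y = E_in_I(2)[OF assms]
  note d = m_dvd[OF assms]
  have carriers: "carrier (G x Mod kernel x y) = range (exp_coset x (m x y))"
    "carrier (G y Mod kernel y x) = range (exp_coset y (m x y))"
    using x y assms by (simp_all add: kernel_def carrier_quotient m_sym)
  have val: "exponent_map x y (exp_coset x (m x y) k) = exp_coset y (m x y) k" for k
    by (rule exponent_map_exp_coset[OF x d(1)])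
  show "exponent_map x y \<in> hom (G x Mod kernel x y) (G y Mod kernel y x)"
    unfolding hom_def carriers using x y by (auto simp: val exp_coset_set_mult)
  have "inj_on (exponent_map x y) (range (exp_coset x (m x y)))"
    using x y d by (auto simp: inj_on_def val exp_coset_eq_iff)
  then show "bij_betw (exponent_map x y) (carrier (G x Mod kernel x y)) (carrier (G y Mod kernel y x))"
    unfolding carriers bij_betw_def by (simp add: image_image val)
qed

lemma image_exponent_map:
  assumes "(x, y) \<in> E" and "(y, z) \<in> E"
  shows "coset_union_image (G x) (kernel x y) (exponent_map x y) (kernel x y <#>\<^bsub>G x\<^esub> kernel x z)
    = kernel y x <#>\<^bsub>G y\<^esub> kernel y z"
  using coset_union_image_exponent_map[OF assms(1) gcd_dvd1[of "m x y" "m x z"], of 0]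
    E_in_I[OF assms(1)] m_gcd[OF assms] m_sym[OF assms(1)]
  by (simp add: kernel_def exp_coset_set_mult)

lemma composition_exponent_map:
  assumes "(x, y) \<in> E" and "(y, z) \<in> E"
    and "C \<in> carrier (G x Mod (kernel x y <#>\<^bsub>G x\<^esub> kernel x z))"
  shows "coset_union_image (G y) (kernel y z) (exponent_map y z)
      (coset_union_image (G x) (kernel x y) (exponent_map x y) C)
    = coset_union_image (G x) (kernel x z) (exponent_map x z) C"
proof -
  define d where "d = gcd (m x y) (m x z)"
  have d: "d dvd m x y" "d dvd m x z" "d dvd m y z"
    unfolding d_def using m_gcd[OF assms(1,2)] by (metis gcd_dvd1 gcd_dvd2)+
  from assms(3) obtain k where "C = exp_coset x d k"
    using E_in_I(1)[OF assms(1)] by (auto simp: kernel_def exp_coset_set_mult carrier_quotient d_def)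
  then show ?thesis
    using coset_union_image_exponent_map[OF assms(1) d(1)]
      coset_union_image_exponent_map[OF assms(2) d(3)]
      coset_union_image_exponent_map[OF E_trans[OF assms(1,2)] d(2)]
    by simp
qed

sublocale group_pair I E G kernel "\<lambda>x y. kernel y x" exponent_map
proof (rule group_pair.intro)
  show "equiv I E" by (rule equiv_E)
  show "group (G x)" if "x \<in> I" for x
    using generated_cyclic[OF that] by (simp add: generated_cyclic_def comm_group_def)
  show "disjoint_family_on (\<lambda>x. carrier (G x)) I" by (rule disjoint_G)
  show normal: "kernel x y \<lhd> G x" if "(x, y) \<in> E" for x y
    unfolding kernel_def exp_coset_def
    by (rule generated_cyclic.normal_exponent_class[OF generated_cyclic[OF E_in_I(1)[OF that]]])
  show "kernel y x \<lhd> G y" if "(x, y) \<in> E" for x y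
    by (rule normal[OF E_sym[OF that]])
qed (rule exponent_map_iso)

sublocale group_frame I E G kernel "\<lambda>x y. kernel y x" exponent_map
proof
  show diag: "kernel x x = {\<one>\<^bsub>G x\<^esub>}" if "x \<in> I" for x
    using that m_diag[OF E_refl[OF that]] by (simp add: kernel_def exp_coset_order) (simp add: gpow_def)
  show "exponent_map x x C = C" if x: "x \<in> I" and C: "C \<in> carrier (G x Mod {\<one>\<^bsub>G x\<^esub>})" for x C
  proof -
    have "C \<in> range (exp_coset x (m x x))"
      using C diag[OF x] carrier_quotient[OF x] unfolding kernel_def by metis
    then show ?thesis
      using exponent_map_exp_coset[OF x m_dvd(1)[OF E_refl[OF x]]] by auto
  qed
  show "exponent_map y x D = inv_into (carrier (G x Mod kernel x y)) (exponent_map x y) D"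
    if xy: "(x, y) \<in> E" and D: "D \<in> carrier (G y Mod kernel y x)" for x y D
  proof -
    note I = E_in_I[OF xy]
    from D obtain k where k: "D = exp_coset y (m x y) k"
      using carrier_quotient[OF I(2)] m_sym[OF xy] by (auto simp: kernel_def)
    have "inv_into (carrier (G x Mod kernel x y)) (exponent_map x y) D = exp_coset x (m x y) k"
    proof (rule inv_into_f_eq)
      show "inj_on (exponent_map x y) (carrier (G x Mod kernel x y))"
        using exponent_map_iso[OF xy] by (simp add: iso_def bij_betw_def)
      show "exp_coset x (m x y) k \<in> carrier (G x Mod kernel x y)"
        by (simp add: kernel_def carrier_quotient[OF I(1)])
      show "exponent_map x y (exp_coset x (m x y) k) = D"
        using exponent_map_exp_coset[OF I(1) m_dvd(1)[OF xy]] k by simp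
    qed
    then show ?thesis
      using exponent_map_exp_coset[OF I(2) m_dvd(2)[OF xy]] k by simp
  qed
qed (simp_all add: image_exponent_map composition_exponent_map)

section \<open>The algebra of relations\<close>

text \<open>
  The coset of \<open>k\<close> is related to the coset of \<open>k + c\<close> for every \<open>k\<close>, so only the difference of
  the exponents matters.
\<close>

lemma atomic_rel_eq:
  assumes "(x, y) \<in> E"
  shows "atomic_rel x y (exp_coset x (m x y) c)
    = {(gpow x i, gpow y j) | i j. [j - i = c] (mod int (m x y))}" (is "?L = ?R")
proof -
  note x = E_in_I(1)[OF assms]
  have L: "?L = (\<Union>k. exp_coset x (m x y) k \<times> exp_coset y (m x y) (k + c))"
    using x m_dvd(1)[OF assms]
    by (simp add: atomic_rel_def kernel_def rcosets_exp_coset exp_coset_set_mult exponent_map_exp_coset)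
  show ?thesis
  proof
    show "?L \<subseteq> ?R"
    proof
      fix p assume "p \<in> ?L"
      then obtain k i j where "p = (gpow x i, gpow y j)"
        and "[i = k] (mod int (m x y))" "[j = k + c] (mod int (m x y))"
        unfolding L by (auto simp: exp_coset_eq)
      moreover from this have "[j - i = k + c - k] (mod int (m x y))"
        by (intro cong_diff)
      ultimately show "p \<in> ?R" by auto
    qed
    show "?R \<subseteq> ?L"
    proof
      fix p assume "p \<in> ?R"
      then obtain i j where p: "p = (gpow x i, gpow y j)" and "[j - i = c] (mod int (m x y))"
        by blast
      then have "[j = i + c] (mod int (m x y))"
        by (simp add: cong_iff_dvd_diff algebra_simps)
      then have "p \<in> exp_coset x (m x y) i \<times> exp_coset y (m x y) (i + c)"
        using p by (auto simp: exp_coset_eq)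
      then show "p \<in> ?L" unfolding L by blast
    qed
  qed
qed

definition largest_relation :: "'a rel" where
  "largest_relation = {(gpow x i, gpow y j) | x y i j. (x, y) \<in> E}"

definition saturated :: "'a rel \<Rightarrow> bool" where
  "saturated R \<longleftrightarrow> R \<subseteq> largest_relation \<and>
     (\<forall>x y i j i' j'. (x, y) \<in> E \<longrightarrow> [j - i = j' - i'] (mod int (m x y)) \<longrightarrow>
        (gpow x i, gpow y j) \<in> R \<longrightarrow> (gpow x i', gpow y j') \<in> R)"

lemma saturatedI:
  assumes "R \<subseteq> largest_relation"
    and "\<And>x y i j i' j'. (x, y) \<in> E \<Longrightarrow> [j - i = j' - i'] (mod int (m x y)) \<Longrightarrow>
      (gpow x i, gpow y j) \<in> R \<Longrightarrow> (gpow x i', gpow y j') \<in> R"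
  shows "saturated R"
  using assms by (simp add: saturated_def)

lemma saturatedD:
  "saturated R \<Longrightarrow> (gpow x i, gpow y j) \<in> R \<Longrightarrow> (x, y) \<in> E \<Longrightarrow>
    [j - i = j' - i'] (mod int (m x y)) \<Longrightarrow> (gpow x i', gpow y j') \<in> R"
  unfolding saturated_def by blast

lemma saturatedE:
  assumes "saturated R" and "p \<in> R"
  obtains x y i j where "(x, y) \<in> E" "p = (gpow x i, gpow y j)"
  using assms unfolding saturated_def largest_relation_def by blast

lemma saturated_atomic_rel:
  assumes xy: "(x, y) \<in> E"
  shows "saturated (atomic_rel x y (exp_coset x (m x y) c))"
proof (rule saturatedI)
  show "atomic_rel x y (exp_coset x (m x y) c) \<subseteq> largest_relation"
    unfolding atomic_rel_eq[OF xy] largest_relation_def using xy by blast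
next
  fix u v i j i' j'
  assume uv: "(u, v) \<in> E" and cong: "[j - i = j' - i'] (mod int (m u v))"
    and mem: "(gpow u i, gpow v j) \<in> atomic_rel x y (exp_coset x (m x y) c)"
  then obtain k l where kl: "gpow u i = gpow x k" "gpow v j = gpow y l"
    "[l - k = c] (mod int (m x y))"
    unfolding atomic_rel_eq[OF xy] by blast
  have "u = x" "v = y"
    using index_unique[OF kl(1)] index_unique[OF kl(2)] E_in_I[OF uv] E_in_I[OF xy] by simp_all
  \<comment> \<open>The two exponents of one element may differ, but only by a multiple of the group order.\<close>
  have "[i = k] (mod int (m x y))" "[j = l] (mod int (m x y))"
    using kl(1,2) \<open>u = x\<close> \<open>v = y\<close> E_in_I[OF xy] m_dvd[OF xy]
    by (auto simp: gpow_eq_iff intro: cong_dvd_modulus)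
  then have "[j - i = l - k] (mod int (m x y))" by (intro cong_diff)
  then have "[j' - i' = c] (mod int (m x y))"
    using cong kl(3) \<open>u = x\<close> \<open>v = y\<close> by (metis cong_sym cong_trans)
  then show "(gpow u i', gpow v j') \<in> atomic_rel x y (exp_coset x (m x y) c)"
    unfolding atomic_rel_eq[OF xy] using \<open>u = x\<close> \<open>v = y\<close> by blast
qed

lemma saturated_UN:
  assumes "\<And>t. t \<in> T \<Longrightarrow> saturated (F t)"
  shows "saturated (\<Union>t\<in>T. F t)"
proof (rule saturatedI)
  show "(\<Union>t\<in>T. F t) \<subseteq> largest_relation"
    using assms by (auto simp: saturated_def)
next
  fix x y i j i' j'
  assume step: "(x, y) \<in> E" "[j - i = j' - i'] (mod int (m x y))"
    and "(gpow x i, gpow y j) \<in> (\<Union>t\<in>T. F t)"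
  then obtain t where t: "t \<in> T" and mem: "(gpow x i, gpow y j) \<in> F t" by blast
  have "(gpow x i', gpow y j') \<in> F t"
    by (rule saturatedD[OF assms[OF t] mem step])
  with t show "(gpow x i', gpow y j') \<in> (\<Union>t\<in>T. F t)" by blast
qed

text \<open>
  A saturated relation is recovered by collecting, for each of its pairs, the atomic relation
  that contains the pair.
\<close>

lemma group_relations_eq_saturated: "group_relations = Collect saturated"
proof (intro equalityI subsetI CollectI)
  fix R assume "R \<in> group_relations"
  then obtain X where X: "X \<subseteq> {(x, y, C). (x, y) \<in> E \<and> C \<in> rcosets\<^bsub>G x\<^esub> (kernel x y)}"
    and R: "R = (\<Union>(x, y, C) \<in> X. atomic_rel x y C)"
    unfolding group_relations_def by blast
  show "saturated R"
    unfolding R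
  proof (rule saturated_UN, clarify)
    fix x y C assume "(x, y, C) \<in> X"
    from subsetD[OF X this] have xy: "(x, y) \<in> E" and "C \<in> rcosets\<^bsub>G x\<^esub> (kernel x y)"
      by simp_all
    then have "C \<in> range (exp_coset x (m x y))"
      using rcosets_exp_coset[OF E_in_I(1)[OF xy]] by (simp add: kernel_def)
    then show "saturated (atomic_rel x y C)"
      using saturated_atomic_rel[OF xy] by blast
  qed
next
  fix R assume "R \<in> Collect saturated"
  then have R: "saturated R" by simp
  define X where "X = {(x, y, exp_coset x (m x y) (j - i)) | x y i j.
    (x, y) \<in> E \<and> (gpow x i, gpow y j) \<in> R}"
  have "R = (\<Union>(x, y, C) \<in> X. atomic_rel x y C)"
  proof (intro equalityI subsetI)
    fix p assume "p \<in> R"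
    with R obtain x y i j where xy: "(x, y) \<in> E" and p: "p = (gpow x i, gpow y j)"
      by (rule saturatedE)
    have "(x, y, exp_coset x (m x y) (j - i)) \<in> X"
      using \<open>p \<in> R\<close> xy unfolding X_def p by blast
    moreover have "p \<in> atomic_rel x y (exp_coset x (m x y) (j - i))"
      unfolding atomic_rel_eq[OF xy] p using cong_refl by blast
    ultimately show "p \<in> (\<Union>(x, y, C) \<in> X. atomic_rel x y C)" by blast
  next
    fix p assume "p \<in> (\<Union>(x, y, C) \<in> X. atomic_rel x y C)"
    then obtain x y i j where xy: "(x, y) \<in> E" and mem: "(gpow x i, gpow y j) \<in> R"
      and "p \<in> atomic_rel x y (exp_coset x (m x y) (j - i))"
      unfolding X_def by blast
    then obtain i' j' where "p = (gpow x i', gpow y j')"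
      and "[j' - i' = j - i] (mod int (m x y))"
      unfolding atomic_rel_eq[OF xy] by blast
    then show "p \<in> R"
      using saturatedD[OF R mem xy] by (simp add: cong_sym)
  qed
  moreover have "exp_coset x (m x y) k \<in> rcosets\<^bsub>G x\<^esub> (kernel x y)" if "(x, y) \<in> E" for x y k
    using rcosets_exp_coset[OF E_in_I(1)[OF that]] by (simp add: kernel_def)
  then have "X \<subseteq> {(x, y, C). (x, y) \<in> E \<and> C \<in> rcosets\<^bsub>G x\<^esub> (kernel x y)}"
    unfolding X_def by auto
  ultimately show "R \<in> group_relations"
    unfolding group_relations_def by blast
qed

lemma saturated_largest_relation: "saturated largest_relation"
  unfolding saturated_def largest_relation_def by blast

lemma saturated_diff:
  assumes R: "saturated R"
  shows "saturated (largest_relation - R)"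
proof -
  have "(gpow x i, gpow y j) \<in> R"
    if "(x, y) \<in> E" "[j - i = j' - i'] (mod int (m x y))" "(gpow x i', gpow y j') \<in> R"
    for x y i j i' j'
    using saturatedD[OF R that(3,1) cong_sym[OF that(2)]] .
  then show ?thesis
    using saturated_largest_relation unfolding saturated_def by blast
qed

lemma saturated_Id_on: "saturated (Id_on (\<Union>x \<in> I. carrier (G x)))"
proof (rule saturatedI)
  show "Id_on (\<Union>x \<in> I. carrier (G x)) \<subseteq> largest_relation"
    unfolding largest_relation_def using carrier_eq E_refl by blast
next
  fix x y i j i' j'
  assume xy: "(x, y) \<in> E" and cong: "[j - i = j' - i'] (mod int (m x y))"
    and "(gpow x i, gpow y j) \<in> Id_on (\<Union>x \<in> I. carrier (G x))"
  then have eq: "gpow x i = gpow y j" by (simp add: Id_on_iff)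
  note I = E_in_I[OF xy]
  have y: "y = x" using index_unique[OF eq I] by simp
  have "[j - i = i - i] (mod int (order (G x)))"
    using eq I(1) by (intro cong_diff) (auto simp: y gpow_eq_iff cong_sym)
  then have "[j' - i' = 0] (mod int (order (G x)))"
    using cong m_diag[OF xy] y by (metis cancel_comm_monoid_add_class.diff_cancel cong_sym cong_trans)
  then have "gpow x i' = gpow x j'"
    using I(1) by (metis gpow_eq_iff cong_diff_iff_cong_0 cong_sym)
  then show "(gpow x i', gpow y j') \<in> Id_on (\<Union>x \<in> I. carrier (G x))"
    using I(1) carrier_eq[OF I(1)] y by (auto simp: Id_on_iff)
qed

lemma saturated_converse:
  assumes R: "saturated R"
  shows "saturated (R\<inverse>)"
proof (rule saturatedI)
  show "R\<inverse> \<subseteq> largest_relation"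
    using R E_sym unfolding saturated_def largest_relation_def by blast
next
  fix x y i j i' j'
  assume xy: "(x, y) \<in> E" and cong: "[j - i = j' - i'] (mod int (m x y))"
    and mem: "(gpow x i, gpow y j) \<in> R\<inverse>"
  have "[i - j = i' - j'] (mod int (m y x))"
    using cong_uminus[OF cong] m_sym[OF xy] by simp
  then show "(gpow x i', gpow y j') \<in> R\<inverse>"
    using saturatedD[OF R _ E_sym[OF xy]] mem by blast
qed

text \<open>
  Moving a pair of the composition within its residue class modulo \<open>m x z\<close> asks for a new middle
  exponent with prescribed residues modulo \<open>m x y\<close> and \<open>m y z\<close>. These two residues agree modulo
  \<open>m x z\<close>, hence modulo the gcd of the two moduli, which divides \<open>m x z\<close>.
\<close>

lemma saturated_relcomp:
  assumes R: "saturated R" and S: "saturated S"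
  shows "saturated (R O S)"
proof (rule saturatedI, rule subsetI)
  fix p assume "p \<in> R O S"
  then obtain a b c where abc: "p = (a, c)" "(a, b) \<in> R" "(b, c) \<in> S" by blast
  obtain x y i j where xy: "(x, y) \<in> E" and "(a, b) = (gpow x i, gpow y j)"
    by (rule saturatedE[OF R abc(2)])
  then have ab: "a = gpow x i" "b = gpow y j" by simp_all
  obtain y' z j' k where yz: "(y', z) \<in> E" and "(b, c) = (gpow y' j', gpow z k)"
    by (rule saturatedE[OF S abc(3)])
  then have bc: "b = gpow y' j'" "c = gpow z k" by simp_all
  have "gpow y j = gpow y' j'" using ab(2) bc(1) by simp
  then have "y = y'" using E_in_I(2)[OF xy] E_in_I(1)[OF yz] by (rule index_unique)
  then have "(x, z) \<in> E" using E_trans[OF xy] yz by simp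
  then show "p \<in> largest_relation"
    using abc(1) ab(1) bc(2) unfolding largest_relation_def by blast
next
  fix x z i k i' k'
  assume xz: "(x, z) \<in> E" and cong: "[k - i = k' - i'] (mod int (m x z))"
    and "(gpow x i, gpow z k) \<in> R O S"
  then obtain b where b: "(gpow x i, b) \<in> R" "(b, gpow z k) \<in> S" by blast
  obtain x' y i0 j
    where x'y: "(x', y) \<in> E" and "(gpow x i, b) = (gpow x' i0, gpow y j)"
    by (rule saturatedE[OF R b(1)])
  then have ab: "gpow x i = gpow x' i0" "b = gpow y j" by simp_all
  have "x = x'" by (rule index_unique[OF ab(1) E_in_I(1)[OF xz] E_in_I(1)[OF x'y]])
  then have xy: "(x, y) \<in> E" using x'y by simp
  have yz: "(y, z) \<in> E" by (rule E_trans[OF E_sym[OF xy] xz])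
  have "int (gcd (m x y) (m y z)) dvd int (m x z)"
    using m_gcd(1)[OF xy yz] by simp
  then have "[k - i = k' - i'] (mod gcd (int (m x y)) (int (m y z)))"
    using cong_dvd_modulus[OF cong] by simp
  then have "[i' + (j - i) = k' - (k - j)] (mod gcd (int (m x y)) (int (m y z)))"
    by (simp add: cong_iff_dvd_diff algebra_simps)
  then obtain j' where j': "[j' = i' + (j - i)] (mod int (m x y))"
    "[j' = k' - (k - j)] (mod int (m y z))"
    by (rule simultaneous_congruence)
  have "[j - i = j' - i'] (mod int (m x y))"
    using cong_diff[OF cong_sym[OF j'(1)] cong_refl[of i']] by simp
  then have "(gpow x i', gpow y j') \<in> R"
    using saturatedD[OF R _ xy] b(1) ab(2) by blast
  moreover have "[k - j = k' - j'] (mod int (m y z))"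
    using cong_diff[OF cong_refl[of k'] cong_sym[OF j'(2)]] by simp
  then have "(gpow y j', gpow z k') \<in> S"
    using saturatedD[OF S _ yz] b(2) ab(2) by blast
  ultimately show "(gpow x i', gpow z k') \<in> R O S" by blast
qed

lemma group_relation_algebra: group_relation_algebra_exists
proof -
  have "\<Union> group_relations = largest_relation"
    unfolding group_relations_eq_saturated
    using saturated_largest_relation by (auto simp: saturated_def)
  moreover have "saturated (R \<union> S)" "saturated (R \<inter> S)" if "saturated R" "saturated S" for R S
    using that unfolding saturated_def by blast+
  ultimately show ?thesis
    unfolding group_relation_algebra_exists_def
    by (simp add: group_relations_eq_saturated saturated_diff saturated_Id_on
        saturated_relcomp saturated_converse)
qed

end

theorem theorem3p8:
  fixes I :: "'i set" and E :: "'i rel"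
    and G :: "'i \<Rightarrow> ('a, 'b) monoid_scheme"
    and m :: "'i \<Rightarrow> 'i \<Rightarrow> nat"
  assumes "equiv I E"
    and "\<And>x. x \<in> I \<Longrightarrow> group (G x)"
    and "\<And>x. x \<in> I \<Longrightarrow> finite (carrier (G x))"
    and "\<And>x. x \<in> I \<Longrightarrow> cyclic_group (G x)"
    and "disjoint_family_on (\<lambda>x. carrier (G x)) I"
    and "\<And>x y. (x, y) \<in> E \<Longrightarrow> m x y > 0"
    and "index_conditions E G m"
  shows "\<exists>H K \<phi>.
           group_frame I E G H K \<phi> \<and>
           group_pair.group_relation_algebra_exists I E G H \<phi> \<and>
           (\<forall>(x, y) \<in> E. m x y = order (G x Mod H x y))"
proof -
  have "\<exists>a. generated_cyclic (G x) a" if "x \<in> I" for x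
  proof -
    from that obtain a where "a \<in> carrier (G x)"
      "carrier (G x) = range (\<lambda>k::int. a [^]\<^bsub>G x\<^esub> k)"
      using group.cyclic_group assms(2,4) by blast
    then show ?thesis
      using assms(2,4)[OF that] group.cyclic_imp_abelian_group
      unfolding generated_cyclic_def generated_cyclic_axioms_def by blast
  qed
  then obtain g where g: "\<And>x. x \<in> I \<Longrightarrow> generated_cyclic (G x) (g x)" by metis
  interpret cyclic_system I E G m g
    by (rule cyclic_system.intro[OF assms(1) g assms(5,7)])
  have "m x y = order (G x Mod kernel x y)" if "(x, y) \<in> E" for x y
    unfolding kernel_def exp_coset_def
    using generated_cyclic.order_quotient[OF generated_cyclic m_dvd(1) assms(6)] E_in_I that by metis
  then show ?thesis
    using group_frame_axioms group_relation_algebra by blast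
qed

end
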